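(* Let $(X,\le)$ be a connected locally finite preordered set and let $\mathcal{R}$ be a $2$-torsion free commutative ring with identity. Then any Lie derivation of the incidence algebra $I(X,\mathcal{R})$ is the sum of a derivation of $I(X,\mathcal{R})$ and an $\mathcal{R}$-linear map from $I(X,\mathcal{R})$ to its center.
   Context: A preordered set $(X,\le)$ is a set with a reflexive and transitive binary relation $\le$ (antisymmetry is not assumed). It is locally finite if for any $x\le y$ there are only finitely many $z\in X$ with $x\le z\le y$. It is connected if for any $x,y\in X$ there is a finite path $x=x_0,x_1,\dots,x_n=y$ in $X$ such that for each $k$ the elements $x_k$ and $x_{k+1}$ are comparable ($x_k\le x_{k+1}$ or $x_{k+1}\le x_k$). A ring $\mathcal{R}$ is $2$-torsion free if $2r=0$ implies $r=0$ for $r\in\mathcal{R}$. The incidence algebra of $X$ over $\mathcal{R}$ is $I(X,\mathcal{R})=\{f:X\times X\to\mathcal{R}\mid f(x,y)=0\text{ if }x\not\le y\}$ with pointwise addition and scalar multiplication, and product $(fg)(x,y)=\sum_{x\le z\le y}f(x,z)g(z,y)$. It is an associative $\mathcal{R}$-algebra with identity. For an associative $\mathcal{R}$-algebra $A$ put $[a,b]=ab-ba$. An $\mathcal{R}$-linear map $D:A\to A$ is a derivation if $D(ab)=D(a)b+aD(b)$ for all $a,b\in A$. An $\mathcal{R}$-linear map $L:A\to A$ is a Lie derivation if $L([a,b])=[L(a),b]+[a,L(b)]$ for all $a,b\in A$. *)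

theory Defs
  imports Main "HOL-Library.FuncSet" "HOL-Library.Function_Algebras"
begin

(* A preordered set is a carrier X with a relation r such that "preorder_on X r";
   "x below y" is "(x, y) \<in> r".  Since preorder_on includes r \<subseteq> X \<times> X, all points
   occurring below lie in X. *)

definition locally_finite_rel :: "'a rel \<Rightarrow> bool" where
  "locally_finite_rel r \<longleftrightarrow>
     (\<forall>x y. (x, y) \<in> r \<longrightarrow> finite {z. (x, z) \<in> r \<and> (z, y) \<in> r})"

definition connected_rel :: "'a set \<Rightarrow> 'a rel \<Rightarrow> bool" where
  "connected_rel X r \<longleftrightarrow>
     (\<forall>x\<in>X. \<forall>y\<in>X. \<exists>(n::nat) p. p 0 = x \<and> p n = y \<and> (\<forall>k\<le>n. p k \<in> X) \<and>
        (\<forall>k<n. (p k, p (Suc k)) \<in> r \<or> (p (Suc k), p k) \<in> r))"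

(* The sort {comm_ring, comm_monoid_mult} is that of commutative rings with identity;
   unlike comm_ring_1 it does not exclude the zero ring.

   Elements of the incidence algebra are total functions vanishing off r, hence off X \<times> X,
   so they correspond exactly to functions on X \<times> X vanishing off r.  Sums, differences and
   zero are the pointwise ones of Function_Algebras; the pointwise product given there is
   not the product of the incidence algebra and is not used on its elements. *)

definition incidence_algebra ::
    "'a rel \<Rightarrow> ('a \<Rightarrow> 'a \<Rightarrow> 'r::{comm_ring, comm_monoid_mult}) set" where
  "incidence_algebra r = {f. \<forall>x y. (x, y) \<notin> r \<longrightarrow> f x y = 0}"

definition inc_scale ::
    "'r \<Rightarrow> ('a \<Rightarrow> 'a \<Rightarrow> 'r) \<Rightarrow> 'a \<Rightarrow> 'a \<Rightarrow> 'r::{comm_ring, comm_monoid_mult}" where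
  "inc_scale c f = (\<lambda>x y. c * f x y)"

(* For (x, y) not in r the index set is empty by transitivity, so the product vanishes off r. *)
definition inc_mult ::
    "'a rel \<Rightarrow> ('a \<Rightarrow> 'a \<Rightarrow> 'r) \<Rightarrow> ('a \<Rightarrow> 'a \<Rightarrow> 'r) \<Rightarrow>
     'a \<Rightarrow> 'a \<Rightarrow> 'r::{comm_ring, comm_monoid_mult}" where
  "inc_mult r f g = (\<lambda>x y. \<Sum>z | (x, z) \<in> r \<and> (z, y) \<in> r. f x z * g z y)"

definition inc_bracket ::
    "'a rel \<Rightarrow> ('a \<Rightarrow> 'a \<Rightarrow> 'r) \<Rightarrow> ('a \<Rightarrow> 'a \<Rightarrow> 'r) \<Rightarrow>
     'a \<Rightarrow> 'a \<Rightarrow> 'r::{comm_ring, comm_monoid_mult}" where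
  "inc_bracket r f g = inc_mult r f g - inc_mult r g f"

definition inc_center ::
    "'a rel \<Rightarrow> ('a \<Rightarrow> 'a \<Rightarrow> 'r::{comm_ring, comm_monoid_mult}) set" where
  "inc_center r =
     {f \<in> incidence_algebra r. \<forall>g\<in>incidence_algebra r. inc_mult r f g = inc_mult r g f}"

(* R-linear maps from the incidence algebra into M; values off the incidence algebra are
   unconstrained. *)
definition inc_linear ::
    "'a rel \<Rightarrow> ('a \<Rightarrow> 'a \<Rightarrow> 'r::{comm_ring, comm_monoid_mult}) set \<Rightarrow>
     (('a \<Rightarrow> 'a \<Rightarrow> 'r) \<Rightarrow> ('a \<Rightarrow> 'a \<Rightarrow> 'r)) \<Rightarrow> bool" where
  "inc_linear r M T \<longleftrightarrow>
     T \<in> incidence_algebra r \<rightarrow> M \<and>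
     (\<forall>f\<in>incidence_algebra r. \<forall>g\<in>incidence_algebra r. T (f + g) = T f + T g) \<and>
     (\<forall>c. \<forall>f\<in>incidence_algebra r. T (inc_scale c f) = inc_scale c (T f))"

definition inc_derivation ::
    "'a rel \<Rightarrow> (('a \<Rightarrow> 'a \<Rightarrow> 'r) \<Rightarrow> ('a \<Rightarrow> 'a \<Rightarrow> 'r::{comm_ring, comm_monoid_mult})) \<Rightarrow> bool" where
  "inc_derivation r D \<longleftrightarrow>
     inc_linear r (incidence_algebra r) D \<and>
     (\<forall>f\<in>incidence_algebra r. \<forall>g\<in>incidence_algebra r.
        D (inc_mult r f g) = inc_mult r (D f) g + inc_mult r f (D g))"

definition inc_lie_derivation ::
    "'a rel \<Rightarrow> (('a \<Rightarrow> 'a \<Rightarrow> 'r) \<Rightarrow> ('a \<Rightarrow> 'a \<Rightarrow> 'r::{comm_ring, comm_monoid_mult})) \<Rightarrow> bool" where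
  "inc_lie_derivation r L \<longleftrightarrow>
     inc_linear r (incidence_algebra r) L \<and>
     (\<forall>f\<in>incidence_algebra r. \<forall>g\<in>incidence_algebra r.
        L (inc_bracket r f g) = inc_bracket r (L f) g + inc_bracket r f (L g))"

end

theory Submission
  imports Defs
begin

text \<open>Every element \<open>f\<close> has entries \<open>f(x, y)\<close> indexed by the pairs \<open>x \<le> y\<close>, and the proof follows
  the pattern for matrices. Since an element need not be a finite combination of matrix units
  \<open>e\<^bsub>xy\<^esub>\<close>, and \<open>L\<close> is compatible with finite sums only, single entries of \<open>f\<close> are reached by
  brackets with matrix units.

  The idempotents \<open>e\<^bsub>xx\<^esub>\<close> commute with each other. Applying \<open>L\<close> to \<open>[e\<^bsub>xx\<^esub>, e\<^bsub>yy\<^esub>] = 0\<close> shows that the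
  off-diagonal entries of all \<open>L(e\<^bsub>xx\<^esub>)\<close> are those of \<open>- [e\<^bsub>xx\<^esub>, h]\<close> for one element \<open>h\<close>
  (\<open>idempotent_images_diagonalizable\<close>). Adding the inner derivation \<open>[\<cdot>, h]\<close> therefore makes every
  \<open>L(e\<^bsub>xx\<^esub>)\<close> diagonal. The entries of this diagonal agree at comparable points
  (\<open>idempotent_image_constant\<close>), so that \<open>L(e\<^bsub>xx\<^esub>)\<close> is central and \<open>L\<close> commutes with the bracket
  with \<open>e\<^bsub>xx\<^esub>\<close>.

  For \<open>u \<noteq> v\<close> the double bracket \<open>[e\<^bsub>uu\<^esub>, [f, e\<^bsub>vv\<^esub>]] = f(u, v) e\<^bsub>uv\<^esub> + f(v, u) e\<^bsub>vu\<^esub>\<close> then gives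
  \<open>(L f)(u, v) = c(u, v) f(u, v)\<close> for a weight \<open>c\<close> (\<open>L_off_diagonal\<close>). That \<open>f(v, u)\<close>
  does not contribute is a first use of the absence of 2-torsion. Brackets of two matrix units
  give \<open>c(u, w) = c(u, v) + c(v, w)\<close> (\<open>weight_additive\<close>, where 2-torsion enters again for
  \<open>u = w\<close>). Hence multiplying the entries by \<open>c\<close> is a derivation. What remains of \<open>L\<close> after
  subtracting it has diagonal values only, and the bracket of \<open>f\<close> with \<open>e\<^bsub>uv\<^esub>\<close> shows that these
  agree at comparable points (\<open>L_diagonal_constant\<close>); such diagonal elements are central.\<close>

section \<open>The incidence algebra as an associative algebra\<close>

locale locally_finite_preorder =
  fixes X :: "'a set" and r :: "'a rel"
  assumes preorder: "preorder_on X r"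
    and locally_finite: "locally_finite_rel r"
begin

lemma r_trans: "(x, y) \<in> r \<Longrightarrow> (y, z) \<in> r \<Longrightarrow> (x, z) \<in> r"
  using preorder unfolding preorder_on_def by (blast dest: transD)

lemma r_refl: assumes "(x, y) \<in> r" shows "(x, x) \<in> r" "(y, y) \<in> r"
  using preorder assms unfolding preorder_on_def refl_on_def by blast+

lemma finite_interval [simp]: "finite {z. (x, z) \<in> r \<and> (z, y) \<in> r}"
proof (cases "(x, y) \<in> r")
  case True
  then show ?thesis using locally_finite unfolding locally_finite_rel_def by blast
next
  case False
  then have "{z. (x, z) \<in> r \<and> (z, y) \<in> r} = {}" using r_trans by blast
  then show ?thesis by (metis finite.emptyI)
qed

lemma incidence_zero: "f \<in> incidence_algebra r \<Longrightarrow> (x, y) \<notin> r \<Longrightarrow> f x y = 0"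
  by (simp add: incidence_algebra_def)

lemma incidence_algebra_add:
  "f \<in> incidence_algebra r \<Longrightarrow> g \<in> incidence_algebra r \<Longrightarrow> f + g \<in> incidence_algebra r"
  by (simp add: incidence_algebra_def)

lemma incidence_algebra_diff:
  "f \<in> incidence_algebra r \<Longrightarrow> g \<in> incidence_algebra r \<Longrightarrow> f - g \<in> incidence_algebra r"
  by (simp add: incidence_algebra_def)

lemma inc_mult_closed: "inc_mult r f g \<in> incidence_algebra r"
proof -
  have "inc_mult r f g x y = 0" if "(x, y) \<notin> r" for x y
    unfolding inc_mult_def using that r_trans by (intro sum.neutral) blast
  then show ?thesis by (simp add: incidence_algebra_def)
qed

lemma inc_bracket_closed: "inc_bracket r f g \<in> incidence_algebra r"
  unfolding inc_bracket_def by (intro incidence_algebra_diff inc_mult_closed)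

lemma inc_mult_add_left: "inc_mult r (f + g) h = inc_mult r f h + inc_mult r g h"
  by (intro ext) (simp add: inc_mult_def distrib_right sum.distrib)

lemma inc_mult_add_right: "inc_mult r h (f + g) = inc_mult r h f + inc_mult r h g"
  by (intro ext) (simp add: inc_mult_def distrib_left sum.distrib)

lemma inc_mult_diff_left: "inc_mult r (f - g) h = inc_mult r f h - inc_mult r g h"
  by (intro ext) (simp add: inc_mult_def left_diff_distrib sum_subtractf)

lemma inc_mult_diff_right: "inc_mult r h (f - g) = inc_mult r h f - inc_mult r h g"
  by (intro ext) (simp add: inc_mult_def right_diff_distrib sum_subtractf)

lemma inc_mult_scale_left: "inc_mult r (inc_scale c f) h = inc_scale c (inc_mult r f h)"
  by (intro ext) (simp add: inc_mult_def inc_scale_def sum_distrib_left mult.assoc)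

lemma inc_mult_scale_right: "inc_mult r h (inc_scale c f) = inc_scale c (inc_mult r h f)"
  by (intro ext) (simp add: inc_mult_def inc_scale_def sum_distrib_left mult.left_commute)

lemmas inc_mult_bilinear = inc_mult_add_left inc_mult_add_right inc_mult_diff_left
  inc_mult_diff_right inc_mult_scale_left inc_mult_scale_right

lemma inc_bracket_add_left: "inc_bracket r (f + g) h = inc_bracket r f h + inc_bracket r g h"
  by (simp add: inc_bracket_def inc_mult_bilinear)

lemma inc_bracket_add_right: "inc_bracket r h (f + g) = inc_bracket r h f + inc_bracket r h g"
  by (simp add: inc_bracket_def inc_mult_bilinear)

lemma inc_bracket_scale_left: "inc_bracket r (inc_scale c f) g = inc_scale c (inc_bracket r f g)"
  unfolding inc_bracket_def inc_mult_bilinear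
  by (simp add: inc_scale_def fun_eq_iff right_diff_distrib)

lemma inc_bracket_scale_right: "inc_bracket r f (inc_scale c g) = inc_scale c (inc_bracket r f g)"
  unfolding inc_bracket_def inc_mult_bilinear
  by (simp add: inc_scale_def fun_eq_iff right_diff_distrib)

lemmas inc_bracket_bilinear = inc_bracket_add_left inc_bracket_add_right
  inc_bracket_scale_left inc_bracket_scale_right

text \<open>Both inner intervals may be enlarged to the whole interval from \<open>x\<close> to \<open>y\<close>, because the
  middle factor vanishes off the preorder; the two sides then differ by the order of summation.\<close>

lemma inc_mult_assoc:
  assumes "g \<in> incidence_algebra r"
  shows "inc_mult r (inc_mult r f g) h = inc_mult r f (inc_mult r g h)"
proof (intro ext)
  fix x y
  let ?I = "{z. (x, z) \<in> r \<and> (z, y) \<in> r}"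
  have left: "inc_mult r f g x z = (\<Sum>w\<in>?I. f x w * g w z)" if "z \<in> ?I" for z
    unfolding inc_mult_def using that
    by (intro sum.mono_neutral_left)
      (auto intro: r_trans, metis assms incidence_zero mult_zero_right)
  have right: "inc_mult r g h w y = (\<Sum>z\<in>?I. g w z * h z y)" if "w \<in> ?I" for w
    unfolding inc_mult_def using that
    by (intro sum.mono_neutral_left)
      (auto intro: r_trans, metis assms incidence_zero mult_zero_left)
  have "inc_mult r (inc_mult r f g) h x y = (\<Sum>z\<in>?I. (\<Sum>w\<in>?I. f x w * g w z) * h z y)"
    unfolding inc_mult_def[of r "inc_mult r f g"] by (intro sum.cong refl) (simp only: left)
  also have "\<dots> = (\<Sum>w\<in>?I. f x w * (\<Sum>z\<in>?I. g w z * h z y))"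
    unfolding sum_distrib_left sum_distrib_right mult.assoc by (rule sum.swap)
  also have "\<dots> = inc_mult r f (inc_mult r g h) x y"
    unfolding inc_mult_def[of r f "inc_mult r g h"] by (intro sum.cong refl) (simp only: right)
  finally show "inc_mult r (inc_mult r f g) h x y = inc_mult r f (inc_mult r g h) x y" .
qed

section \<open>Linear maps, derivations and Lie derivations\<close>

lemma inc_linear_add:
  assumes "inc_linear r (incidence_algebra r) S" "inc_linear r (incidence_algebra r) T"
  shows "inc_linear r (incidence_algebra r) (\<lambda>f. S f + T f)"
  using assms unfolding inc_linear_def
  by (auto simp: incidence_algebra_add Pi_iff inc_scale_def fun_eq_iff algebra_simps)

lemma inc_linear_diff:
  assumes "inc_linear r (incidence_algebra r) S" "inc_linear r (incidence_algebra r) T"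
  shows "inc_linear r (incidence_algebra r) (\<lambda>f. S f - T f)"
  using assms unfolding inc_linear_def
  by (auto simp: incidence_algebra_diff Pi_iff inc_scale_def fun_eq_iff algebra_simps)

lemma inc_linear_closed:
  "inc_linear r M T \<Longrightarrow> f \<in> incidence_algebra r \<Longrightarrow> T f \<in> M"
  by (auto simp: inc_linear_def)

lemma inc_derivation_diff:
  assumes "inc_derivation r D" "inc_derivation r E"
  shows "inc_derivation r (\<lambda>f. D f - E f)"
  using assms unfolding inc_derivation_def
  by (auto simp: inc_linear_diff inc_mult_bilinear algebra_simps)

lemma inc_lie_derivation_add:
  assumes "inc_lie_derivation r L" "inc_lie_derivation r M"
  shows "inc_lie_derivation r (\<lambda>f. L f + M f)"
  using assms unfolding inc_lie_derivation_def
  by (auto simp: inc_linear_add inc_bracket_bilinear add_ac)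

lemma inc_linear_map_diff:
  assumes "inc_linear r M T" "f \<in> incidence_algebra r" "g \<in> incidence_algebra r"
  shows "T (f - g) = T f - T g"
proof -
  have "T (f - g + g) = T (f - g) + T g"
    using assms incidence_algebra_diff unfolding inc_linear_def by blast
  then show ?thesis by (simp add: algebra_simps)
qed

lemma inc_derivation_imp_lie_derivation:
  assumes "inc_derivation r D"
  shows "inc_lie_derivation r D"
proof -
  have lin: "inc_linear r (incidence_algebra r) D"
    using assms by (simp add: inc_derivation_def)
  show ?thesis
    using assms unfolding inc_derivation_def inc_lie_derivation_def inc_bracket_def
    by (simp add: inc_linear_map_diff[OF lin] inc_mult_closed algebra_simps)
qed

lemma inner_derivation:
  assumes "h \<in> incidence_algebra r"
  shows "inc_derivation r (\<lambda>f. inc_bracket r f h)"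
proof -
  have "inc_linear r (incidence_algebra r) (\<lambda>f. inc_bracket r f h)"
    unfolding inc_linear_def
    by (simp add: inc_bracket_closed inc_bracket_bilinear)
  then show ?thesis
    unfolding inc_derivation_def
    by (simp add: inc_bracket_def inc_mult_bilinear inc_mult_assoc assms algebra_simps)
qed

text \<open>The derivations that multiply every entry by a weight; additivity of the weight along
  the preorder is the Leibniz rule for the matrix units.\<close>

lemma weight_derivation:
  assumes "\<And>x y z. (x, y) \<in> r \<Longrightarrow> (y, z) \<in> r \<Longrightarrow> c x z = c x y + c y z"
  shows "inc_derivation r (\<lambda>f x y. c x y * f x y)"
proof -
  have "inc_linear r (incidence_algebra r) (\<lambda>f x y. c x y * f x y)"
    by (auto simp: inc_linear_def incidence_algebra_def inc_scale_def fun_eq_iff algebra_simps)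
  moreover have "(\<lambda>x y. c x y * inc_mult r f g x y) =
      inc_mult r (\<lambda>x y. c x y * f x y) g + inc_mult r f (\<lambda>x y. c x y * g x y)" for f g
  proof (intro ext)
    fix x y
    have "c x y * inc_mult r f g x y =
        (\<Sum>z | (x, z) \<in> r \<and> (z, y) \<in> r. c x z * f x z * g z y + f x z * (c z y * g z y))"
      unfolding inc_mult_def sum_distrib_left
      by (intro sum.cong refl) (auto simp: assms algebra_simps)
    then show "c x y * inc_mult r f g x y =
        (inc_mult r (\<lambda>x y. c x y * f x y) g + inc_mult r f (\<lambda>x y. c x y * g x y)) x y"
      by (simp add: inc_mult_def sum.distrib)
  qed
  ultimately show ?thesis by (simp add: inc_derivation_def)
qed

section \<open>Matrix units and diagonal elements\<close>

definition matrix_unit :: "'a \<Rightarrow> 'a \<Rightarrow> 'a \<Rightarrow> 'a \<Rightarrow> 'r::{comm_ring, comm_monoid_mult}" where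
  "matrix_unit u v = (\<lambda>x y. if x = u \<and> y = v then 1 else 0)"

lemma matrix_unit_apply: "matrix_unit u v x y = (if x = u \<and> y = v then 1 else 0)"
  by (simp add: matrix_unit_def)

lemma matrix_unit_closed: "(u, v) \<in> r \<Longrightarrow> matrix_unit u v \<in> incidence_algebra r"
  by (auto simp: matrix_unit_apply incidence_algebra_def)

lemma inc_mult_matrix_unit_right:
  assumes "f \<in> incidence_algebra r" "(u, v) \<in> r"
  shows "inc_mult r f (matrix_unit u v) x y = (if y = v then f x u else 0)"
proof -
  have "inc_mult r f (matrix_unit u v) x y =
      (\<Sum>z | (x, z) \<in> r \<and> (z, y) \<in> r. if z = u then (if y = v then f x u else 0) else 0)"
    unfolding inc_mult_def by (intro sum.cong refl) (auto simp: matrix_unit_apply)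
  then show ?thesis
    using assms by (auto simp: sum.delta incidence_zero)
qed

lemma inc_mult_matrix_unit_left:
  assumes "f \<in> incidence_algebra r" "(u, v) \<in> r"
  shows "inc_mult r (matrix_unit u v) f x y = (if x = u then f v y else 0)"
proof -
  have "inc_mult r (matrix_unit u v) f x y =
      (\<Sum>z | (x, z) \<in> r \<and> (z, y) \<in> r. if z = v then (if x = u then f v y else 0) else 0)"
    unfolding inc_mult_def by (intro sum.cong refl) (auto simp: matrix_unit_apply)
  then show ?thesis
    using assms by (auto simp: sum.delta incidence_zero)
qed

lemma inc_bracket_matrix_unit_right:
  assumes "f \<in> incidence_algebra r" "(u, v) \<in> r"
  shows "inc_bracket r f (matrix_unit u v) x y =
    (if y = v then f x u else 0) - (if x = u then f v y else 0)"
  using assms by (simp add: inc_bracket_def inc_mult_matrix_unit_left inc_mult_matrix_unit_right)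

lemma inc_bracket_matrix_unit_left:
  assumes "f \<in> incidence_algebra r" "(u, v) \<in> r"
  shows "inc_bracket r (matrix_unit u v) f x y =
    (if x = u then f v y else 0) - (if y = v then f x u else 0)"
  using assms by (simp add: inc_bracket_def inc_mult_matrix_unit_left inc_mult_matrix_unit_right)

lemma inc_mult_diagonal_right:
  assumes "f \<in> incidence_algebra r" "\<And>x y. x \<noteq> y \<Longrightarrow> d x y = 0"
  shows "inc_mult r f d x y = f x y * d y y"
proof -
  have "inc_mult r f d x y =
      (\<Sum>z | (x, z) \<in> r \<and> (z, y) \<in> r. if z = y then f x y * d y y else 0)"
    unfolding inc_mult_def by (intro sum.cong refl) (auto simp: assms(2))
  then show ?thesis
    using r_refl[of x y] incidence_zero[OF assms(1), of x y]
    by (cases "(x, y) \<in> r") (auto simp: sum.delta)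
qed

lemma inc_mult_diagonal_left:
  assumes "f \<in> incidence_algebra r" "\<And>x y. x \<noteq> y \<Longrightarrow> d x y = 0"
  shows "inc_mult r d f x y = d x x * f x y"
proof -
  have "inc_mult r d f x y =
      (\<Sum>z | (x, z) \<in> r \<and> (z, y) \<in> r. if z = x then d x x * f x y else 0)"
    unfolding inc_mult_def by (intro sum.cong refl) (auto simp: assms(2))
  then show ?thesis
    using r_refl[of x y] incidence_zero[OF assms(1), of x y]
    by (cases "(x, y) \<in> r") (auto simp: sum.delta)
qed

lemma diagonal_in_center:
  assumes "d \<in> incidence_algebra r" "\<And>x y. x \<noteq> y \<Longrightarrow> d x y = 0"
    and "\<And>x y. (x, y) \<in> r \<Longrightarrow> d x x = d y y"
  shows "d \<in> inc_center r"
proof -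
  have "inc_mult r d f x y = inc_mult r f d x y" if "f \<in> incidence_algebra r" for f x y
    using incidence_zero[OF that, of x y] assms(3)[of x y]
    by (cases "(x, y) \<in> r")
      (auto simp: inc_mult_diagonal_left[OF that assms(2)] inc_mult_diagonal_right[OF that assms(2)]
        mult.commute)
  then show ?thesis
    using assms(1) unfolding inc_center_def by (auto intro!: ext)
qed

end

section \<open>Lie derivations that keep the diagonal idempotents diagonal\<close>

locale diagonal_lie_derivation = locally_finite_preorder X r
  for X :: "'a set" and r :: "'a rel" +
  fixes L :: "('a \<Rightarrow> 'a \<Rightarrow> 'r) \<Rightarrow> ('a \<Rightarrow> 'a \<Rightarrow> 'r::{comm_ring, comm_monoid_mult})"
  assumes two_torsion_free: "\<And>c::'r. c + c = 0 \<Longrightarrow> c = 0"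
    and lie: "inc_lie_derivation r L"
    and idempotent_diagonal:
      "\<And>x u v. (x, x) \<in> r \<Longrightarrow> u \<noteq> v \<Longrightarrow> L (matrix_unit x x) u v = 0"
begin

lemma L_linear: "inc_linear r (incidence_algebra r) L"
  using lie by (simp add: inc_lie_derivation_def)

lemmas L_closed = inc_linear_closed[OF L_linear]

lemma L_bracket:
  "f \<in> incidence_algebra r \<Longrightarrow> g \<in> incidence_algebra r \<Longrightarrow>
    L (inc_bracket r f g) = inc_bracket r (L f) g + inc_bracket r f (L g)"
  using lie by (simp add: inc_lie_derivation_def)

lemma L_scale: "f \<in> incidence_algebra r \<Longrightarrow> L (inc_scale c f) x y = c * L f x y"
  using L_linear by (simp add: inc_linear_def inc_scale_def)

lemma L_add:
  "f \<in> incidence_algebra r \<Longrightarrow> g \<in> incidence_algebra r \<Longrightarrow> L (f + g) = L f + L g"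
  using L_linear by (simp add: inc_linear_def)

lemma bracket_idempotent_image_right:
  assumes "f \<in> incidence_algebra r" "(p, p) \<in> r"
  shows "inc_bracket r f (L (matrix_unit p p)) x y =
    f x y * (L (matrix_unit p p) y y - L (matrix_unit p p) x x)"
  using assms idempotent_diagonal[OF assms(2)]
  by (simp add: inc_bracket_def inc_mult_diagonal_right inc_mult_diagonal_left algebra_simps)

lemma bracket_idempotent_image_left:
  assumes "f \<in> incidence_algebra r" "(p, p) \<in> r"
  shows "inc_bracket r (L (matrix_unit p p)) f x y =
    f x y * (L (matrix_unit p p) x x - L (matrix_unit p p) y y)"
  using assms idempotent_diagonal[OF assms(2)]
  by (simp add: inc_bracket_def inc_mult_diagonal_right inc_mult_diagonal_left algebra_simps)

lemma bracket_idempotent_matrix_unit: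
  assumes "(u, v) \<in> r" "u \<noteq> v"
  shows "inc_bracket r (matrix_unit u u) (matrix_unit u v) = matrix_unit u v"
  using assms r_refl[OF assms(1)]
  by (intro ext) (auto simp: inc_bracket_matrix_unit_right matrix_unit_closed matrix_unit_apply)

text \<open>Compare the \<open>(u, v)\<close> entries in the image of the bracket of the idempotent at \<open>p\<close> with the
  matrix unit at \<open>(u, v)\<close>. This bracket is a multiple, by 0, 1 or -1, of the matrix unit, and taking
  the bracket with the idempotent multiplies the \<open>(u, v)\<close> entry by the same factor, so what remains
  is the difference of two diagonal entries.\<close>

lemma idempotent_image_constant:
  assumes "(p, p) \<in> r" "(u, v) \<in> r"
  shows "L (matrix_unit p p) u u = L (matrix_unit p p) v v"
proof (cases "u = v")
  case False
  define E where "E = (matrix_unit u v :: 'a \<Rightarrow> 'a \<Rightarrow> 'r)"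
  define e where "e = (matrix_unit p p :: 'a \<Rightarrow> 'a \<Rightarrow> 'r)"
  have E: "E \<in> incidence_algebra r" and e: "e \<in> incidence_algebra r"
    using assms by (simp_all add: E_def e_def matrix_unit_closed)
  \<comment> \<open>the eigenvalue of the bracket with \<open>e\<close> at the matrix unit \<open>E\<close>\<close>
  define s :: 'r where "s = (if p = u then 1 else if p = v then - 1 else 0)"
  have "inc_bracket r e E = inc_scale s E"
    using False assms unfolding e_def s_def
    by (intro ext)
      (auto simp: inc_bracket_matrix_unit_left matrix_unit_closed matrix_unit_apply inc_scale_def E_def)
  then have "s * L E u v = L (inc_bracket r e E) u v"
    using E by (simp add: L_scale)
  also have "\<dots> = inc_bracket r (L e) E u v + inc_bracket r e (L E) u v"
    using L_bracket[OF e E] by simp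
  also have "inc_bracket r e (L E) u v = s * L E u v"
    using False assms L_closed[OF E] unfolding e_def s_def
    by (auto simp: inc_bracket_matrix_unit_left)
  also have "inc_bracket r (L e) E u v = L e u u - L e v v"
    using bracket_idempotent_image_left[OF E assms(1)] by (simp add: e_def E_def matrix_unit_apply)
  finally show ?thesis by (simp add: e_def)
qed simp

lemma bracket_idempotent_image_zero:
  assumes "f \<in> incidence_algebra r" "(p, p) \<in> r"
  shows "inc_bracket r (L (matrix_unit p p)) f = 0" "inc_bracket r f (L (matrix_unit p p)) = 0"
proof -
  have "f x y * (L (matrix_unit p p) x x - L (matrix_unit p p) y y) = 0"
    "f x y * (L (matrix_unit p p) y y - L (matrix_unit p p) x x) = 0" for x y
    using incidence_zero[OF assms(1), of x y] idempotent_image_constant[OF assms(2), of x y]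
    by (cases "(x, y) \<in> r"; simp)+
  then show "inc_bracket r (L (matrix_unit p p)) f = 0"
    "inc_bracket r f (L (matrix_unit p p)) = 0"
    by (auto simp: fun_eq_iff bracket_idempotent_image_left[OF assms]
      bracket_idempotent_image_right[OF assms])
qed

lemma L_bracket_idempotent:
  assumes "f \<in> incidence_algebra r" "(p, p) \<in> r"
  shows "L (inc_bracket r (matrix_unit p p) f) = inc_bracket r (matrix_unit p p) (L f)"
    "L (inc_bracket r f (matrix_unit p p)) = inc_bracket r (L f) (matrix_unit p p)"
  using assms by (simp_all add: L_bracket matrix_unit_closed bracket_idempotent_image_zero)

text \<open>The matrix unit at \<open>(u, v)\<close> is its own bracket with the idempotent at \<open>u\<close>, and so is its
  image, because \<open>L\<close> commutes with that bracket. Being reproduced by the bracket kills the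
  diagonal entries; the entry at the opposite place \<open>(v, u)\<close> is equal to its negative.\<close>

lemma
  assumes "(u, v) \<in> r" "u \<noteq> v"
  shows L_matrix_unit_diagonal: "L (matrix_unit u v) x x = 0"
    and L_matrix_unit_opposite: "L (matrix_unit u v) v u = 0"
proof -
  let ?E = "matrix_unit u v :: 'a \<Rightarrow> 'a \<Rightarrow> 'r"
  have E: "?E \<in> incidence_algebra r" using assms by (simp add: matrix_unit_closed)
  have "L ?E = inc_bracket r (matrix_unit u u) (L ?E)"
    using L_bracket_idempotent(1)[OF E r_refl(1)[OF assms(1)]]
    by (simp add: bracket_idempotent_matrix_unit assms)
  then have fixed: "L ?E x y = (if x = u then L ?E u y else 0) - (if y = u then L ?E x u else 0)" for x y
    by (metis inc_bracket_matrix_unit_left[OF L_closed[OF E] r_refl(1)[OF assms(1)]])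
  show "L ?E x x = 0" using fixed[of x x] by (simp split: if_splits)
  have "L ?E v u + L ?E v u = 0"
    using fixed[of v u] assms(2) by (simp add: eq_neg_iff_add_eq_0)
  then show "L ?E v u = 0" by (rule two_torsion_free)
qed

text \<open>Off the diagonal this is the factor in \<open>L_off_diagonal\<close>. The value 0 on the diagonal is
  forced by additivity.\<close>

definition weight :: "'a \<Rightarrow> 'a \<Rightarrow> 'r" where
  "weight u v = (if (u, v) \<in> r \<and> u \<noteq> v then L (matrix_unit u v) u v else 0)"

text \<open>The double bracket with the idempotents at \<open>u\<close> and \<open>v\<close> isolates the entries of \<open>f\<close> at
  \<open>(u, v)\<close> and \<open>(v, u)\<close>. Since \<open>L\<close> commutes with both brackets, the \<open>(u, v)\<close> entry of \<open>L f\<close>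
  depends on these two entries only, and the second does not contribute by
  \<open>L_matrix_unit_opposite\<close>.\<close>

lemma L_off_diagonal:
  assumes f: "f \<in> incidence_algebra r" and neq: "u \<noteq> v"
  shows "L f u v = weight u v * f u v"
proof (cases "(u, v) \<in> r")
  case False
  then show ?thesis
    using L_closed[OF f] by (simp add: incidence_zero weight_def)
next
  case uv: True
  have u: "(u, u) \<in> r" and v: "(v, v) \<in> r" using r_refl[OF uv] by auto
  let ?e = "matrix_unit :: 'a \<Rightarrow> 'a \<Rightarrow> 'a \<Rightarrow> 'a \<Rightarrow> 'r"
  define P where "P = (\<lambda>g. inc_bracket r (?e u u) (inc_bracket r g (?e v v)))"
  have P_apply: "P g x y = (if x = u \<and> y = v then g u v else if x = v \<and> y = u then g v u else 0)"
    if "g \<in> incidence_algebra r" for g x y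
    using neq unfolding P_def
    by (auto simp: inc_bracket_matrix_unit_left[OF inc_bracket_closed u]
        inc_bracket_matrix_unit_right[OF that v])
  have "L (P f) = P (L f)"
    unfolding P_def using f u v by (simp add: L_bracket_idempotent inc_bracket_closed)
  then have Lf: "L f u v = L (P f) u v"
    using P_apply[OF L_closed[OF f]] by simp
  have part: "L (inc_scale (f u v) (?e u v)) u v = weight u v * f u v"
    using uv neq by (simp add: L_scale matrix_unit_closed weight_def mult.commute)
  show ?thesis
  proof (cases "(v, u) \<in> r")
    case False
    then have "P f = inc_scale (f u v) (?e u v)"
      using f by (intro ext) (auto simp: P_apply inc_scale_def matrix_unit_apply incidence_zero)
    then show ?thesis using Lf part by simp
  next
    case True
    have "P f = inc_scale (f u v) (?e u v) + inc_scale (f v u) (?e v u)"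
      using f neq by (intro ext) (auto simp: P_apply inc_scale_def matrix_unit_apply)
    moreover have "inc_scale (f u v) (?e u v) \<in> incidence_algebra r"
      "inc_scale (f v u) (?e v u) \<in> incidence_algebra r"
      using uv True by (auto simp: incidence_algebra_def inc_scale_def matrix_unit_apply)
    ultimately have "L (P f) u v = weight u v * f u v + f v u * L (?e v u) u v"
      using part True by (simp add: L_add L_scale matrix_unit_closed)
    then show ?thesis
      using Lf L_matrix_unit_opposite[OF True] neq by simp
  qed
qed

lemma L_matrix_unit:
  assumes "(u, v) \<in> r" "u \<noteq> v"
  shows "L (matrix_unit u v) = inc_scale (weight u v) (matrix_unit u v)"
proof (intro ext)
  fix x y
  show "L (matrix_unit u v) x y = inc_scale (weight u v) (matrix_unit u v) x y"
    using assms L_matrix_unit_diagonal[OF assms] L_off_diagonal[OF matrix_unit_closed[OF assms(1)]]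
    by (cases "x = y") (auto simp: inc_scale_def matrix_unit_apply)
qed

lemma L_bracket_matrix_units:
  assumes "(u, v) \<in> r" "u \<noteq> v" "(v, w) \<in> r" "v \<noteq> w"
  shows "L (inc_bracket r (matrix_unit u v) (matrix_unit v w)) =
    inc_scale (weight u v + weight v w) (inc_bracket r (matrix_unit u v) (matrix_unit v w))"
  using assms
  by (simp add: L_bracket matrix_unit_closed L_matrix_unit inc_bracket_scale_left
      inc_bracket_scale_right) (simp add: inc_scale_def fun_eq_iff algebra_simps)

text \<open>For distinct \<open>u\<close>, \<open>v\<close>, \<open>w\<close> the bracket of the matrix units at \<open>(u, v)\<close> and \<open>(v, w)\<close> is the
  matrix unit at \<open>(u, w)\<close>. For \<open>u = w\<close> it is the difference of two idempotents, whose image takes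
  the same value at \<open>(u, u)\<close> and \<open>(v, v)\<close>; but these values are the weight sum and its negative.\<close>

lemma weight_additive:
  assumes uv: "(u, v) \<in> r" and vw: "(v, w) \<in> r"
  shows "weight u w = weight u v + weight v w"
proof (cases "u = v \<or> v = w")
  case True
  then show ?thesis by (auto simp: weight_def)
next
  case False
  let ?e = "matrix_unit :: 'a \<Rightarrow> 'a \<Rightarrow> 'a \<Rightarrow> 'a \<Rightarrow> 'r"
  let ?B = "inc_bracket r (?e u v) (?e v w)"
  have LB: "L ?B = inc_scale (weight u v + weight v w) ?B"
    using L_bracket_matrix_units uv vw False by blast
  show ?thesis
  proof (cases "u = w")
    case False
    have "?B = ?e u w"
      using \<open>\<not> (u = v \<or> v = w)\<close> False uv vw
      by (intro ext) (auto simp: inc_bracket_matrix_unit_right matrix_unit_closed matrix_unit_apply)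
    then have "L (?e u w) u w = weight u v + weight v w"
      using LB by (simp add: inc_scale_def matrix_unit_apply)
    then show ?thesis using False r_trans[OF uv vw] by (simp add: weight_def)
  next
    case True
    have u: "(u, u) \<in> r" and v: "(v, v) \<in> r" using r_refl[OF uv] by auto
    have B: "?B = ?e u u - ?e v v"
      using False True uv vw
      by (intro ext) (auto simp: inc_bracket_matrix_unit_right matrix_unit_closed matrix_unit_apply)
    then have "L ?B = L (?e u u) - L (?e v v)"
      using u v by (simp add: inc_linear_map_diff[OF L_linear] matrix_unit_closed)
    then have "L ?B u u = L ?B v v"
      using idempotent_image_constant[OF u uv] idempotent_image_constant[OF v uv] by simp
    define s where "s = weight u v + weight v w"
    have "s = - s"
      using \<open>L ?B u u = L ?B v v\<close> False unfolding LB[folded s_def] unfolding B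
      by (auto simp: inc_scale_def matrix_unit_apply)
    then have "s + s = 0" by (simp only: eq_neg_iff_add_eq_0)
    then have "weight u v + weight v w = 0" unfolding s_def by (rule two_torsion_free)
    then show ?thesis using True by (simp add: weight_def)
  qed
qed

text \<open>Compare the \<open>(u, v)\<close> entries in the image of the bracket of \<open>f\<close> with the matrix unit at
  \<open>(u, v)\<close>: the multiples of the weight cancel.\<close>

lemma L_diagonal_constant:
  assumes f: "f \<in> incidence_algebra r" and uv: "(u, v) \<in> r"
  shows "L f u u = L f v v"
proof (cases "u = v")
  case False
  let ?E = "matrix_unit u v :: 'a \<Rightarrow> 'a \<Rightarrow> 'r"
  have E: "?E \<in> incidence_algebra r" using uv by (rule matrix_unit_closed)
  have entry: "inc_bracket r g ?E u v = g u u - g v v" if "g \<in> incidence_algebra r" for g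
    using inc_bracket_matrix_unit_right[OF that uv] by simp
  have "weight u v * (f u u - f v v) = L (inc_bracket r f ?E) u v"
    using False by (simp add: L_off_diagonal inc_bracket_closed entry[OF f])
  also have "\<dots> = (L f u u - L f v v) + weight u v * (f u u - f v v)"
    using uv False
    by (simp add: L_bracket[OF f E] L_matrix_unit inc_bracket_scale_right entry f L_closed[OF f])
      (simp add: inc_scale_def entry f)
  finally show ?thesis by simp
qed simp

lemma L_minus_weight_central:
  assumes f: "f \<in> incidence_algebra r"
  shows "L f - (\<lambda>x y. weight x y * f x y) \<in> inc_center r"
proof (rule diagonal_in_center)
  show "L f - (\<lambda>x y. weight x y * f x y) \<in> incidence_algebra r"
    using L_closed[OF f] f by (simp add: incidence_algebra_def)
qed (simp_all add: L_off_diagonal f L_diagonal_constant, simp_all add: weight_def L_diagonal_constant f)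

end

section \<open>Reduction by an inner derivation\<close>

context locally_finite_preorder
begin

text \<open>The off-diagonal entries of the images of the idempotents fit together to one element of
  the algebra. Since the idempotents commute pairwise, the image of the idempotent at \<open>x\<close> can be
  nonzero off the diagonal only in row and column \<open>x\<close>, and the two idempotents that see the
  place \<open>(u, v)\<close> have opposite entries there.\<close>

lemma idempotent_images_diagonalizable:
  fixes L :: "('a \<Rightarrow> 'a \<Rightarrow> 'r) \<Rightarrow> ('a \<Rightarrow> 'a \<Rightarrow> 'r::{comm_ring, comm_monoid_mult})"
  assumes lie: "inc_lie_derivation r L"
  obtains h where "h \<in> incidence_algebra r"
    "\<And>x u v. (x, x) \<in> r \<Longrightarrow> u \<noteq> v \<Longrightarrow>
      (L (matrix_unit x x) + inc_bracket r (matrix_unit x x) h) u v = 0"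
proof -
  let ?e = "\<lambda>x. matrix_unit x x :: 'a \<Rightarrow> 'a \<Rightarrow> 'r"
  have lin: "inc_linear r (incidence_algebra r) L"
    using lie by (simp add: inc_lie_derivation_def)
  have L_e: "L (?e x) \<in> incidence_algebra r" if "(x, x) \<in> r" for x
    using that by (intro inc_linear_closed[OF lin] matrix_unit_closed)
  have "(0 :: 'a \<Rightarrow> 'a \<Rightarrow> 'r) \<in> incidence_algebra r" by (simp add: incidence_algebra_def)
  from inc_linear_map_diff[OF lin this this] have L_zero: "L 0 = 0" by simp
  have commute: "((if v = y then L (?e x) u y else 0) - (if u = y then L (?e x) y v else 0)) +
      ((if u = x then L (?e y) x v else 0) - (if v = x then L (?e y) u x else 0)) = 0"
    if x: "(x, x) \<in> r" and y: "(y, y) \<in> r" for x y u v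
  proof -
    have "inc_bracket r (?e x) (?e y) = 0"
      using x y by (intro ext)
        (auto simp: inc_bracket_matrix_unit_right matrix_unit_closed matrix_unit_apply)
    moreover have "L (inc_bracket r (?e x) (?e y)) =
        inc_bracket r (L (?e x)) (?e y) + inc_bracket r (?e x) (L (?e y))"
      using lie matrix_unit_closed[OF x] matrix_unit_closed[OF y]
      unfolding inc_lie_derivation_def by blast
    ultimately have "inc_bracket r (L (?e x)) (?e y) + inc_bracket r (?e x) (L (?e y)) = 0"
      by (simp add: L_zero)
    from fun_cong[OF fun_cong[OF this, of u], of v]
    have "inc_bracket r (L (?e x)) (?e y) u v + inc_bracket r (?e x) (L (?e y)) u v = 0"
      by simp
    then show ?thesis
      using x y by (simp add: inc_bracket_matrix_unit_right inc_bracket_matrix_unit_left L_e)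
  qed
  define h where "h u v = (if (u, v) \<in> r \<and> u \<noteq> v then L (?e v) u v else 0)" for u v
  have h: "h \<in> incidence_algebra r" by (simp add: incidence_algebra_def h_def)
  have "(L (?e x) + inc_bracket r (?e x) h) u v = 0" if x: "(x, x) \<in> r" and "u \<noteq> v" for x u v
  proof (cases "(u, v) \<in> r")
    case False
    then show ?thesis
      using incidence_zero[OF L_e[OF x]] incidence_zero[OF inc_bracket_closed] by simp
  next
    case True
    then have "(v, v) \<in> r" using r_refl by blast
    from commute[OF x this, of v u] commute[OF x this, of u v] show ?thesis
      using \<open>u \<noteq> v\<close> True inc_bracket_matrix_unit_left[OF h x]
      by (auto simp: h_def split: if_splits)
  qed
  with h show ?thesis by (rule that)
qed

end

theorem theorem3p10:
  fixes X :: "'a set" and r :: "'a rel"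
    and L :: "('a \<Rightarrow> 'a \<Rightarrow> 'r) \<Rightarrow> ('a \<Rightarrow> 'a \<Rightarrow> 'r::{comm_ring, comm_monoid_mult})"
  assumes "preorder_on X r"
    and "locally_finite_rel r"
    and "connected_rel X r"
    and two_torsion_free: "\<And>c::'r. c + c = 0 \<Longrightarrow> c = 0"
    and "inc_lie_derivation r L"
  shows "\<exists>D F. inc_derivation r D \<and> inc_linear r (inc_center r) F \<and>
           (\<forall>f\<in>incidence_algebra r. L f = D f + F f)"
proof -
  interpret locally_finite_preorder X r by standard fact+
  obtain h where h: "h \<in> incidence_algebra r"
    and diag: "\<And>x u v. (x, x) \<in> r \<Longrightarrow> u \<noteq> v \<Longrightarrow>
      (L (matrix_unit x x) + inc_bracket r (matrix_unit x x) h) u v = 0"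
    using idempotent_images_diagonalizable[OF assms(5)] by blast
  define L' where "L' = (\<lambda>f. L f + inc_bracket r f h)"
  interpret diagonal_lie_derivation X r L'
  proof
    show "inc_lie_derivation r L'"
      unfolding L'_def
      by (rule inc_lie_derivation_add[OF assms(5)
            inc_derivation_imp_lie_derivation[OF inner_derivation[OF h]]])
    show "L' (matrix_unit x x) u v = 0" if "(x, x) \<in> r" "u \<noteq> v" for x u v
      using diag[OF that] by (simp add: L'_def)
  qed (rule two_torsion_free)
  let ?W = "\<lambda>f x y. weight x y * f x y"
  define D where "D = (\<lambda>f. ?W f - inc_bracket r f h)"
  define F where "F = (\<lambda>f. L' f - ?W f)"
  have W: "inc_derivation r ?W"
    using weight_additive by (rule weight_derivation)
  have "inc_derivation r D"
    unfolding D_def by (rule inc_derivation_diff[OF W inner_derivation[OF h]])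
  moreover have "inc_linear r (incidence_algebra r) F"
    unfolding F_def using W by (intro inc_linear_diff L_linear) (simp add: inc_derivation_def)
  then have "inc_linear r (inc_center r) F"
    using L_minus_weight_central by (auto simp: inc_linear_def F_def)
  moreover have "L f = D f + F f" for f
    by (simp add: D_def F_def L'_def)
  ultimately show ?thesis by blast
qed

end
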